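(* Let $\boldsymbol X$ be a $d$-dimensional Bernoulli random vector with pmf $f\in\mathcal{B}_K$. If $\boldsymbol X$ is a $\Sigma_{cx}$-smallest element in $\mathcal{SB}_d$, then the random vector $\boldsymbol V=U\boldsymbol X+(1-U)(\boldsymbol 1_d-\boldsymbol X)$, where $U$ is a standard uniform random variable independent of $\boldsymbol X$, is $\Sigma_{cx}$-smallest in the class $\mathcal{C}_d^{\mathrm{EM}}$ of extremal mixture copulas, and $\boldsymbol V$ is $\Sigma$-countermonotonic.
   Context: $\mathcal{X}_n=\{0,1\}^n$, and $\boldsymbol 1_d$ is the all-ones vector of length $d$. $\mathcal{SB}_d$ is the class of probability mass functions (pmfs) $f:\{0,1\}^d\to[0,1]$ of random vectors whose one-dimensional marginals are all Bernoulli with mean $1/2$. $\mathcal{B}_K=\{f\in\mathcal{SB}_d:\ \exists\,\boldsymbol x\in\mathcal{X}_d,\ f(\boldsymbol x)=f(\boldsymbol 1_d-\boldsymbol x)=\tfrac12\}$. Convex order: for random variables with finite mean, $Y_1\le_{cx}Y_2$ if $E[\phi(Y_1)]\le E[\phi(Y_2)]$ for all convex $\phi:\mathbb{R}\to\mathbb{R}$ for which the expectations are finite. A $\Sigma_{cx}$-smallest element in a class of distributions $\mathcal{F}$ is a random vector $\boldsymbol Y=(Y_1,\dots,Y_d)$ with distribution in $\mathcal{F}$ such that $\sum_jY_j\le_{cx}\sum_jY'_j$ for every random vector $\boldsymbol Y'$ with distribution in $\mathcal{F}$. A copula is identified with the distribution of a random vector with standard uniform marginals. For $\boldsymbol i\in\mathcal{X}_{d-1}$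 let $\boldsymbol s_{\boldsymbol i}=(i_1,\dots,i_{d-1},0)$ and $J_{\boldsymbol i}$ the set of positions of the ones in $\boldsymbol s_{\boldsymbol i}$. The extremal copula $C_{\boldsymbol i}$ is the distribution function of the vector $(V_1,\dots,V_d)$ with $V_j=U$ if $j\in J_{\boldsymbol i}$ and $V_j=1-U$ if $j\notin J_{\boldsymbol i}$, with $U$ standard uniform. An extremal mixture copula is a convex combination $\sum_{\boldsymbol i\in\mathcal{X}_{d-1}}w_{\boldsymbol i}C_{\boldsymbol i}$ ($w_{\boldsymbol i}\ge0$, $\sum w_{\boldsymbol i}=1$); $\mathcal{C}_d^{\mathrm{EM}}$ is the class of all of these. A bivariate random vector $(X,Y)$ is countermonotonic if $\mathbb{P}[(X_1-X_2)(Y_1-Y_2)\le0]=1$, where $(X_1,Y_1)$, $(X_2,Y_2)$ are independent copies of $(X,Y)$. A random vector $\boldsymbol Y=(Y_1,\dots,Y_d)$ is $\Sigma$-countermonotonic if for every $J\subseteq\{1,\dots,d\}$ the pair $(\sum_{j\in J}Y_j,\sum_{j\notin J}Y_j)$ is countermonotonic (empty sums are $0$). *)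

theory Defs
  imports "HOL-Probability.Probability"
begin

text \<open>
  Vectors of length \<open>d\<close> are extensional functions on the index set \<open>{1..d}\<close>, and Borel sets of
  \<open>d\<close>-dimensional space are those of the finite product below.
\<close>

abbreviation Rd :: "nat \<Rightarrow> (nat \<Rightarrow> real) measure" where
  "Rd d \<equiv> PiM {1..d} (\<lambda>_. borel)"

definition cube :: "nat \<Rightarrow> (nat \<Rightarrow> real) set" where
  "cube d = {1..d} \<rightarrow>\<^sub>E {0, 1}"

definition flip :: "nat \<Rightarrow> (nat \<Rightarrow> real) \<Rightarrow> nat \<Rightarrow> real" where
  "flip d x = (\<lambda>j\<in>{1..d}. 1 - x j)"

definition SB :: "nat \<Rightarrow> (nat \<Rightarrow> real) pmf set" where
  "SB d = {f. set_pmf f \<subseteq> cube d \<and>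
              (\<forall>j\<in>{1..d}. map_pmf (\<lambda>x. x j = 1) f = bernoulli_pmf (1/2))}"

definition B_K :: "nat \<Rightarrow> (nat \<Rightarrow> real) pmf set" where
  "B_K d = {f \<in> SB d. \<exists>x\<in>cube d. pmf f x = 1/2 \<and> pmf f (flip d x) = 1/2}"

text \<open>
  The law on \<open>Rd d\<close> with probability mass function \<open>f\<close>. For \<open>f\<close> supported on \<open>cube d\<close> the restriction
  changes nothing on the support; it only makes the map measurable from the whole type.
\<close>

definition law_of_pmf :: "nat \<Rightarrow> (nat \<Rightarrow> real) pmf \<Rightarrow> (nat \<Rightarrow> real) measure" where
  "law_of_pmf d f = distr (measure_pmf f) (Rd d) (\<lambda>x. restrict x {1..d})"

definition SB_laws :: "nat \<Rightarrow> (nat \<Rightarrow> real) measure set" where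
  "SB_laws d = law_of_pmf d ` SB d"

definition convex_le :: "'a measure \<Rightarrow> ('a \<Rightarrow> real) \<Rightarrow> 'b measure \<Rightarrow> ('b \<Rightarrow> real) \<Rightarrow> bool" where
  "convex_le M Y N Z \<longleftrightarrow>
     integrable M Y \<and> integrable N Z \<and>
     (\<forall>\<phi>::real \<Rightarrow> real. convex_on UNIV \<phi> \<longrightarrow>
        integrable M (\<lambda>\<omega>. \<phi> (Y \<omega>)) \<longrightarrow> integrable N (\<lambda>\<omega>. \<phi> (Z \<omega>)) \<longrightarrow>
        (\<integral>\<omega>. \<phi> (Y \<omega>) \<partial>M) \<le> (\<integral>\<omega>. \<phi> (Z \<omega>) \<partial>N))"

text \<open>
  A class of distributions is a set of probability measures on \<open>Rd d\<close>. HOL cannot quantify over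
  random vectors on sample spaces of all types, so the competitor with law \<open>\<nu>\<close> is the canonical one,
  the identity on \<open>\<nu>\<close>; the lemma below shows that this covers every random vector with law \<open>\<nu>\<close>.
\<close>

definition Sigma_cx_smallest ::
  "nat \<Rightarrow> (nat \<Rightarrow> real) measure set \<Rightarrow> 'a measure \<Rightarrow> ('a \<Rightarrow> nat \<Rightarrow> real) \<Rightarrow> bool" where
  "Sigma_cx_smallest d F M Y \<longleftrightarrow>
     Y \<in> measurable M (Rd d) \<and> distr M (Rd d) Y \<in> F \<and>
     (\<forall>\<nu>\<in>F. convex_le M (\<lambda>\<omega>. \<Sum>j\<in>{1..d}. Y \<omega> j) \<nu> (\<lambda>y. \<Sum>j\<in>{1..d}. y j))"

lemma Sigma_cx_smallest_competitor:
  assumes Y: "Sigma_cx_smallest d F M Y"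
    and Z [measurable]: "Z \<in> measurable N (Rd d)" and F: "distr N (Rd d) Z \<in> F"
  shows "convex_le M (\<lambda>\<omega>. \<Sum>j\<in>{1..d}. Y \<omega> j) N (\<lambda>\<omega>. \<Sum>j\<in>{1..d}. Z \<omega> j)"
proof -
  have le: "convex_le M (\<lambda>\<omega>. \<Sum>j\<in>{1..d}. Y \<omega> j) (distr N (Rd d) Z) (\<lambda>y. \<Sum>j\<in>{1..d}. y j)"
    using Y F unfolding Sigma_cx_smallest_def by blast
  have S [measurable]: "(\<lambda>y. \<Sum>j\<in>{1..d}. y j) \<in> borel_measurable (Rd d)"
    by measurable
  have phi: "\<phi> \<in> borel_measurable borel" if "convex_on UNIV \<phi>" for \<phi> :: "real \<Rightarrow> real"
    using convex_on_continuous[OF open_UNIV that] by (rule borel_measurable_continuous_onI)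
  have phiS: "(\<lambda>y. \<phi> (\<Sum>j\<in>{1..d}. y j)) \<in> borel_measurable (Rd d)" if "convex_on UNIV \<phi>"
    for \<phi> :: "real \<Rightarrow> real"
    using measurable_compose[OF S phi[OF that]] .
  show ?thesis
    using le unfolding convex_le_def
    by (metis (no_types, lifting) integrable_distr_eq[OF Z S] integrable_distr_eq[OF Z phiS]
        integral_distr[OF Z phiS])
qed

definition joint_cdf :: "nat \<Rightarrow> (nat \<Rightarrow> real) measure \<Rightarrow> (nat \<Rightarrow> real) \<Rightarrow> real" where
  "joint_cdf d \<nu> u = measure \<nu> {x \<in> space \<nu>. \<forall>j\<in>{1..d}. x j \<le> u j}"

definition std_uniform :: "real measure" where
  "std_uniform = uniform_measure lborel {0..1}"

definition s_vec :: "nat \<Rightarrow> (nat \<Rightarrow> real) \<Rightarrow> nat \<Rightarrow> real" where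
  "s_vec d i = (\<lambda>j\<in>{1..d}. if j = d then 0 else i j)"

definition J_set :: "nat \<Rightarrow> (nat \<Rightarrow> real) \<Rightarrow> nat set" where
  "J_set d i = {j \<in> {1..d}. s_vec d i j = 1}"

definition extremal_copula :: "nat \<Rightarrow> (nat \<Rightarrow> real) \<Rightarrow> (nat \<Rightarrow> real) \<Rightarrow> real" where
  "extremal_copula d i =
     joint_cdf d (distr std_uniform (Rd d)
       (\<lambda>u. \<lambda>j\<in>{1..d}. if j \<in> J_set d i then u else 1 - u))"

definition EM_copulas :: "nat \<Rightarrow> ((nat \<Rightarrow> real) \<Rightarrow> real) set" where
  "EM_copulas d =
     {C. \<exists>w. (\<forall>i\<in>cube (d - 1). 0 \<le> w i) \<and> (\<Sum>i\<in>cube (d - 1). w i) = 1 \<and>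
             C = (\<lambda>u. \<Sum>i\<in>cube (d - 1). w i * extremal_copula d i u)}"

definition EM_laws :: "nat \<Rightarrow> (nat \<Rightarrow> real) measure set" where
  "EM_laws d = {\<nu>. prob_space \<nu> \<and> sets \<nu> = sets (Rd d) \<and> joint_cdf d \<nu> \<in> EM_copulas d}"

text \<open>The two independent copies are taken on the product space.\<close>

definition countermonotonic :: "'a measure \<Rightarrow> ('a \<Rightarrow> real) \<Rightarrow> ('a \<Rightarrow> real) \<Rightarrow> bool" where
  "countermonotonic M X Y \<longleftrightarrow>
     measure (M \<Otimes>\<^sub>M M)
       {p \<in> space (M \<Otimes>\<^sub>M M). (X (fst p) - X (snd p)) * (Y (fst p) - Y (snd p)) \<le> 0} = 1"

definition Sigma_countermonotonic :: "nat \<Rightarrow> 'a measure \<Rightarrow> ('a \<Rightarrow> nat \<Rightarrow> real) \<Rightarrow> bool" where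
  "Sigma_countermonotonic d M Y \<longleftrightarrow>
     (\<forall>J\<subseteq>{1..d}. countermonotonic M (\<lambda>\<omega>. \<Sum>j\<in>J. Y \<omega> j) (\<lambda>\<omega>. \<Sum>j\<in>{1..d} - J. Y \<omega> j))"

text \<open>
  Independence of random variables with values in different types, for which the library's
  \<open>indep_var\<close> is not applicable: the generated \<open>\<sigma>\<close>-algebras are independent.
\<close>

definition indep_rvs ::
  "'a measure \<Rightarrow> 'b measure \<Rightarrow> ('a \<Rightarrow> 'b) \<Rightarrow> 'c measure \<Rightarrow> ('a \<Rightarrow> 'c) \<Rightarrow> bool" where
  "indep_rvs M S X T Y \<longleftrightarrow>
     prob_space.indep_set M {X -` A \<inter> space M | A. A \<in> sets S} {Y -` B \<inter> space M | B. B \<in> sets T}"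

end

theory Submission
  imports Defs
begin

text \<open>
  Write the support of \<open>X\<close> as an antipodal pair \<open>s, 1 - s\<close> with last coordinate \<open>s\<^sub>d = 0\<close>, and let \<open>J\<close>
  be the set of ones of \<open>s\<close>. Comparing second moments with another antipodal pair gives
  \<open>|card J - d/2| \<le> 1/2\<close>. The variable \<open>U'\<close> that equals \<open>U\<close> on \<open>X = s\<close> and \<open>1 - U\<close> on
  \<open>X = 1 - s\<close> is again uniform, and \<open>V\<close> is almost surely the extremal vector driven by \<open>U'\<close>.
  The sum of an extremal vector with set \<open>K\<close> is \<open>d/2 + (2U - 1)(card K - d/2)\<close>, which increases in convex
  order with \<open>|card K - d/2|\<close>; since \<open>J\<close> minimises this deviation, \<open>V\<close> beats every mixture.
  Complementary partial sums of \<open>V\<close> are affine in \<open>U'\<close> with integer slopes of sum at most \<open>1\<close> in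
  absolute value, hence with slopes that are not of the same sign.
\<close>

declare One_nat_def [simp del]

section \<open>Joint distribution functions determine laws\<close>

text \<open>Half-lines \<open>{..v}\<close> generate the Borel sets of the line, and
  \<open>{..real n}\<close> is a countable cover of it by generators. This cover lets boxes of
  generators generate the finite product, and a box of half-lines is a quadrant.\<close>

lemma sets_Rd_generated_by_quadrants:
  "sets (Rd d) = sigma_sets (space (Rd d))
     (range (\<lambda>u. {x \<in> space (Rd d). \<forall>j\<in>{1..d}. x j \<le> u j}))"
proof -
  \<comment> \<open>The family of index blocks consists of the single block \<open>{1..d}\<close>,
    which already covers the finite index set; so every coordinate of a generator is
    constrained.\<close>
  define P where "P = {{f\<in>({1..d} \<rightarrow>\<^sub>E (UNIV :: real set)). \<forall>i\<in>j. f i \<in> A i} | A j.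
    j \<in> {{1..d}} \<and> A \<in> Pi j (\<lambda>_. range atMost)}"
  have gen: "sets (PiM {1..d} (\<lambda>_. sigma (UNIV :: real set) (range atMost))) =
      sets (sigma ({1..d} \<rightarrow>\<^sub>E UNIV) P)"
    unfolding P_def
  proof (rule sets_PiM_sigma)
    have "\<exists>n::nat. x \<le> real n" for x
      by (rule real_arch_simple)
    then show "\<exists>S\<subseteq>range atMost. countable S \<and> (UNIV :: real set) = \<Union>S" for i :: nat
      by (intro exI[of _ "range (\<lambda>n::nat. {..real n})"]) auto
  qed auto
  have P: "P = range (\<lambda>u. {x \<in> space (Rd d). \<forall>j\<in>{1..d}. x j \<le> u j})"
  proof (intro equalityI subsetI)
    fix S assume "S \<in> P"
    then obtain A where S: "S = {f\<in>{1..d} \<rightarrow>\<^sub>E UNIV. \<forall>i\<in>{1..d}. f i \<in> A i}"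
      and "A \<in> {1..d} \<rightarrow> range atMost"
      unfolding P_def by blast
    then have "\<forall>j\<in>{1..d}. \<exists>v. A j = {..v}"
      by (auto simp: Pi_iff image_iff)
    then obtain u where u: "\<And>j. j \<in> {1..d} \<Longrightarrow> A j = {..u j}"
      by metis
    have "S = {x \<in> space (Rd d). \<forall>j\<in>{1..d}. x j \<le> u j}"
      unfolding S by (auto simp: space_PiM u)
    then show "S \<in> range (\<lambda>u. {x \<in> space (Rd d). \<forall>j\<in>{1..d}. x j \<le> u j})"
      by blast
  next
    fix S assume "S \<in> range (\<lambda>u. {x \<in> space (Rd d). \<forall>j\<in>{1..d}. x j \<le> u j})"
    then obtain u where "S = {x \<in> space (Rd d). \<forall>j\<in>{1..d}. x j \<le> u j}"
      by blast
    then have "S = {f\<in>{1..d} \<rightarrow>\<^sub>E UNIV. \<forall>i\<in>{1..d}. f i \<in> {..u i}}"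
      by (auto simp: space_PiM)
    then show "S \<in> P"
      unfolding P_def mem_Collect_eq
      by (intro exI[of _ "\<lambda>i. {..u i}"] exI[of _ "{1..d}"] conjI) (assumption | simp)+
  qed
  have "P \<subseteq> Pow ({1..d} \<rightarrow>\<^sub>E UNIV)"
    unfolding P_def by auto
  then have "sets (Rd d) = sigma_sets ({1..d} \<rightarrow>\<^sub>E UNIV) P"
    using gen unfolding borel_eq_atMost[symmetric] by (simp only: sets_measure_of)
  then show ?thesis
    by (simp only: P[symmetric]) (simp add: space_PiM)
qed

text \<open>Uniqueness on an intersection-stable generator: two quadrants meet in the quadrant whose
  corner is the coordinatewise minimum, and the quadrants with corners \<open>(n, ..., n)\<close>
  exhaust the space.\<close>

lemma joint_cdf_determines_law:
  assumes "prob_space \<mu>" "prob_space \<nu>"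
    and sets: "sets \<mu> = sets (Rd d)" "sets \<nu> = sets (Rd d)"
    and cdf: "joint_cdf d \<mu> = joint_cdf d \<nu>"
  shows "\<mu> = \<nu>"
proof -
  interpret \<mu>: prob_space \<mu> by fact
  interpret \<nu>: prob_space \<nu> by fact
  let ?Q = "\<lambda>u. {x \<in> space (Rd d). \<forall>j\<in>{1..d}. x j \<le> u j}"
  have space: "space \<mu> = space (Rd d)" "space \<nu> = space (Rd d)"
    using sets[THEN sets_eq_imp_space_eq] .
  show ?thesis
  proof (rule measure_eqI_generator_eq)
    show "Int_stable (range ?Q)"
    proof (rule Int_stableI, safe)
      fix u v :: "nat \<Rightarrow> real"
      show "?Q u \<inter> ?Q v \<in> range ?Q"
        by (rule image_eqI[of _ _ "\<lambda>j. min (u j) (v j)"]) auto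
    qed
    show "range ?Q \<subseteq> Pow (space (Rd d))"
      by auto
    show "emeasure \<mu> S = emeasure \<nu> S" if S: "S \<in> range ?Q" for S
    proof -
      obtain u where u: "S = ?Q u" using S by blast
      have "measure \<mu> S = measure \<nu> S"
        using fun_cong[OF cdf, of u] by (simp add: joint_cdf_def space u)
      then show ?thesis
        by (simp add: \<mu>.emeasure_eq_measure \<nu>.emeasure_eq_measure)
    qed
    show "sets \<mu> = sigma_sets (space (Rd d)) (range ?Q)"
      "sets \<nu> = sigma_sets (space (Rd d)) (range ?Q)"
      unfolding sets by (rule sets_Rd_generated_by_quadrants)+
    show "range (\<lambda>n. ?Q (\<lambda>_. real n)) \<subseteq> range ?Q"
      by auto
    show "(\<Union>n. ?Q (\<lambda>_. real n)) = space (Rd d)"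
    proof safe
      fix x assume "x \<in> space (Rd d)"
      \<comment> \<open>One \<open>n\<close> has to bound all coordinates at once; the sum of
        absolute values dominates each of them.\<close>
      obtain n where "(\<Sum>j\<in>{1..d}. \<bar>x j\<bar>) \<le> real n"
        using real_arch_simple by blast
      moreover have "x j \<le> (\<Sum>j\<in>{1..d}. \<bar>x j\<bar>)" if "j \<in> {1..d}" for j
        using member_le_sum[OF that, of "\<lambda>j. \<bar>x j\<bar>"] by auto
      ultimately have "x \<in> ?Q (\<lambda>_. real n)"
        using \<open>x \<in> space (Rd d)\<close> by fastforce
      then show "x \<in> (\<Union>n. ?Q (\<lambda>_. real n))"
        by blast
    qed
    show "emeasure \<mu> (?Q (\<lambda>_. real n)) \<noteq> \<infinity>" for n
      by simp
  qed
qed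

section \<open>The standard uniform law: reflection and convex functions\<close>

lemma prob_space_std_uniform: "prob_space std_uniform"
  unfolding std_uniform_def by (rule prob_space_uniform_measure) auto

lemma sets_std_uniform [simp, measurable_cong]: "sets std_uniform = sets borel"
  by (simp add: std_uniform_def)

lemma space_std_uniform [simp]: "space std_uniform = UNIV"
  by (simp add: std_uniform_def)

lemma AE_std_uniform: "AE u in std_uniform. 0 \<le> u \<and> u \<le> 1"
  unfolding std_uniform_def by (rule AE_uniform_measureI) auto

text \<open>Lebesgue measure is invariant under \<open>u \<mapsto> 1 - u\<close>, and this map
  preserves the unit interval.\<close>

lemma std_uniform_reflect: "distr std_uniform borel (\<lambda>u. 1 - u) = std_uniform"
proof (rule measure_eqI)
  fix A assume "A \<in> sets (distr std_uniform borel (\<lambda>u. 1 - u))"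
  then have A [measurable]: "A \<in> sets borel" by simp
  have lb: "emeasure lborel ((\<lambda>u. 1 - u) -` B) = emeasure lborel B" if [measurable]: "B \<in> sets borel"
    for B :: "real set"
    using arg_cong[OF lborel_real_affine[of "-1" 1], of "\<lambda>M. emeasure M B"]
    by (simp add: emeasure_density emeasure_distr nn_integral_indicator)
  have [measurable]: "(\<lambda>u. 1 - u) -` A \<in> sets borel"
    using measurable_sets[of "\<lambda>u. 1 - u" borel borel A] by simp
  have "{0..1} \<inter> (\<lambda>u. 1 - u) -` A = (\<lambda>u. 1 - u) -` ({0..1} \<inter> A)"
    by auto
  then show "emeasure (distr std_uniform borel (\<lambda>u. 1 - u)) A = emeasure std_uniform A"
    by (simp add: emeasure_distr std_uniform_def lb del: vimage_Int)
qed simp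

text \<open>A continuous function is bounded on the compact interval that carries all the mass.
  Finite convex functions on the line are continuous, so this settles their integrability
  below.\<close>

lemma integrable_std_uniform_continuous:
  fixes g :: "real \<Rightarrow> real"
  assumes "continuous_on UNIV g"
  shows "integrable std_uniform g"
proof -
  interpret prob_space std_uniform by (rule prob_space_std_uniform)
  have "compact (g ` {0..1})"
    using assms by (intro compact_continuous_image) (auto intro: continuous_on_subset)
  then have "bounded (g ` {0..1})"
    by (rule compact_imp_bounded)
  then obtain B where B: "\<And>u. u \<in> {0..1} \<Longrightarrow> norm (g u) \<le> B"
    unfolding bounded_iff by fastforce
  have [measurable]: "g \<in> borel_measurable borel"
    using assms by (rule borel_measurable_continuous_onI)
  show ?thesis
    by (rule integrable_const_bound[where B = B]) (use AE_std_uniform B in auto)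
qed

text \<open>Since \<open>a\<close> lies between \<open>b\<close> and \<open>- b\<close>, the
  argument with \<open>a\<close> is, for every \<open>u\<close>, the same convex combination of the
  arguments with \<open>b\<close> and \<open>- b\<close>. Reflection of \<open>u\<close> gives the
  latter two equal expectations.\<close>

lemma convex_symmetric_uniform_mono:
  fixes \<phi> :: "real \<Rightarrow> real"
  assumes \<phi>: "convex_on UNIV \<phi>" and ab: "\<bar>a\<bar> \<le> \<bar>b\<bar>"
  shows "(\<integral>u. \<phi> (c + (2 * u - 1) * a) \<partial>std_uniform) \<le> (\<integral>u. \<phi> (c + (2 * u - 1) * b) \<partial>std_uniform)"
proof (cases "b = 0")
  case True
  then show ?thesis using ab by simp
next
  case False
  have cont: "continuous_on UNIV \<phi>"
    using convex_on_continuous[OF open_UNIV \<phi>] .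
  have int: "integrable std_uniform (\<lambda>u. \<phi> (c + (2 * u - 1) * e))" for e
    by (intro integrable_std_uniform_continuous continuous_on_compose2[OF cont] continuous_intros) auto
  have [measurable]: "\<phi> \<in> borel_measurable borel"
    using cont by (rule borel_measurable_continuous_onI)
  have refl: "(\<integral>u. \<phi> (c + (2 * u - 1) * (- b)) \<partial>std_uniform) =
      (\<integral>u. \<phi> (c + (2 * u - 1) * b) \<partial>std_uniform)"
  proof -
    have "(\<integral>u. \<phi> (c + (2 * u - 1) * b) \<partial>std_uniform) =
        (\<integral>u. \<phi> (c + (2 * u - 1) * b) \<partial>distr std_uniform borel (\<lambda>u. 1 - u))"
      by (simp add: std_uniform_reflect)
    also have "\<dots> = (\<integral>u. \<phi> (c + (2 * (1 - u) - 1) * b) \<partial>std_uniform)"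
      by (rule integral_distr) measurable
    also have "(\<lambda>u. c + (2 * (1 - u) - 1) * b) = (\<lambda>u. c + (2 * u - 1) * (- b))"
      by (auto simp: algebra_simps)
    finally show ?thesis by (simp add: fun_eq_iff)
  qed
  \<comment> \<open>The solution of \<open>a = (1 - t) * b + t * (- b)\<close>; it lies in the unit
    interval because \<open>\<bar>a / b\<bar> \<le> 1\<close>.\<close>
  define t where "t = (1 - a / b) / 2"
  have "\<bar>a / b\<bar> \<le> 1"
    using ab False by (simp add: abs_divide)
  then have t: "0 \<le> t" "t \<le> 1"
    unfolding t_def abs_le_iff by auto
  have at: "a = (1 - t) * b + t * (- b)"
    using False by (simp add: t_def field_simps)
  have "\<phi> (c + (2 * u - 1) * a) \<le>
      (1 - t) * \<phi> (c + (2 * u - 1) * b) + t * \<phi> (c + (2 * u - 1) * (- b))" for u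
  proof -
    have "c + (2 * u - 1) * a =
        (1 - t) * (c + (2 * u - 1) * b) + t * (c + (2 * u - 1) * (- b))"
      unfolding at by (simp add: algebra_simps)
    then show ?thesis
      using convex_onD[OF \<phi> t, of "c + (2 * u - 1) * b" "c + (2 * u - 1) * (- b)"] by simp
  qed
  then have "(\<integral>u. \<phi> (c + (2 * u - 1) * a) \<partial>std_uniform) \<le>
      (\<integral>u. (1 - t) * \<phi> (c + (2 * u - 1) * b) + t * \<phi> (c + (2 * u - 1) * (- b)) \<partial>std_uniform)"
    by (intro integral_mono Bochner_Integration.integrable_add integrable_mult_right int)
  also have "\<dots> = (1 - t) * (\<integral>u. \<phi> (c + (2 * u - 1) * b) \<partial>std_uniform) +
      t * (\<integral>u. \<phi> (c + (2 * u - 1) * (- b)) \<partial>std_uniform)"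
    by (subst Bochner_Integration.integral_add)
      (auto simp only: integral_mult_right_zero intro!: integrable_mult_right int)
  also have "\<dots> = (\<integral>u. \<phi> (c + (2 * u - 1) * b) \<partial>std_uniform)"
    unfolding refl by (simp add: algebra_simps)
  finally show ?thesis .
qed

section \<open>Antithetic vectors and extremal mixtures\<close>

text \<open>At a uniform argument this is the vector behind an extremal copula. An arbitrary
  \<open>J\<close> keeps later facts free of the encoding of that set by a point of
  \<open>cube (d - 1)\<close>.\<close>

definition antithetic :: "nat \<Rightarrow> nat set \<Rightarrow> real \<Rightarrow> nat \<Rightarrow> real" where
  "antithetic d J u = (\<lambda>j\<in>{1..d}. if j \<in> J then u else 1 - u)"

lemma measurable_antithetic [measurable]: "antithetic d J \<in> measurable borel (Rd d)"
  unfolding antithetic_def by measurable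

text \<open>Coordinates in \<open>J\<close> contribute \<open>u\<close>, the others
  \<open>1 - u\<close>. The expansion is centred at \<open>u = 1/2\<close> to match the form
  \<open>c + (2 * u - 1) * a\<close> of the convex comparison.\<close>

lemma sum_antithetic:
  assumes "J \<subseteq> {1..d}" "K \<subseteq> {1..d}"
  shows "(\<Sum>j\<in>K. antithetic d J u j) = card K / 2 + (2 * u - 1) * (card (K \<inter> J) - card K / 2)"
proof -
  have fin: "finite K" using assms(2) finite_subset by blast
  have "(\<Sum>j\<in>K. antithetic d J u j) = (\<Sum>j\<in>K. if j \<in> J then u else 1 - u)"
    using assms(2) by (intro sum.cong) (auto simp: antithetic_def)
  also have "\<dots> = card (K \<inter> J) * u + card (K - J) * (1 - u)"
    using fin by (simp add: sum.If_cases Diff_eq)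
  also have "card (K - J) = real (card K) - card (K \<inter> J)"
    using card_Diff_subset_Int[of K J] fin card_mono[of K "K \<inter> J"] by (simp add: of_nat_diff)
  finally show ?thesis
    by (simp add: field_simps)
qed

lemma J_set_subset: "J_set d i \<subseteq> {1..d}"
  by (auto simp: J_set_def)

lemma extremal_copula_antithetic:
  "extremal_copula d i = joint_cdf d (distr std_uniform (Rd d) (antithetic d (J_set d i)))"
  unfolding extremal_copula_def antithetic_def ..

lemma finite_cube: "finite (cube d)"
  unfolding cube_def by (intro finite_PiE) auto

text \<open>
  Since a joint cdf determines the law, the mixture is realised by drawing the index and the uniform
  variable independently.
\<close>

lemma EM_law_mixture:
  assumes "\<nu> \<in> EM_laws d"
  shows "\<exists>w. (\<forall>i\<in>cube (d - 1). 0 \<le> w i) \<and> (\<Sum>i\<in>cube (d - 1). w i) = 1 \<and>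
    (AE y in \<nu>. \<forall>j\<in>{1..d}. 0 \<le> y j \<and> y j \<le> 1) \<and>
    (\<forall>g :: (nat \<Rightarrow> real) \<Rightarrow> real. integrable \<nu> g \<longrightarrow>
      (\<integral>y. g y \<partial>\<nu>) = (\<Sum>i\<in>cube (d - 1). w i * (\<integral>u. g (antithetic d (J_set d i) u) \<partial>std_uniform)))"
proof -
  from assms obtain w where \<nu>: "prob_space \<nu>" "sets \<nu> = sets (Rd d)"
    and w: "\<And>i. i \<in> cube (d - 1) \<Longrightarrow> 0 \<le> w i" "(\<Sum>i\<in>cube (d - 1). w i) = 1"
    and cdf: "joint_cdf d \<nu> = (\<lambda>u. \<Sum>i\<in>cube (d - 1). w i * extremal_copula d i u)"
    unfolding EM_laws_def EM_copulas_def by auto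
  define W where "W = point_measure (cube (d - 1)) (\<lambda>i. ennreal (w i))"
  have space_W: "space W = cube (d - 1)" and sets_W [measurable_cong]: "sets W = Pow (cube (d - 1))"
    by (simp_all add: W_def space_point_measure sets_point_measure)
  have prob_W: "prob_space W"
    by (rule prob_spaceI)
      (simp add: space_W, simp add: W_def emeasure_point_measure_finite finite_cube w(1) sum_ennreal w(2)[simplified])
  interpret W: prob_space W by fact
  interpret S: prob_space std_uniform by (rule prob_space_std_uniform)
  interpret P: pair_prob_space W std_uniform ..
  define T where "T = (\<lambda>p. antithetic d (J_set d (fst p)) (snd p))"
  have T [measurable]: "T \<in> measurable (W \<Otimes>\<^sub>M std_uniform) (Rd d)"
  proof -
    \<comment> \<open>Every subset of the finite index space is measurable, hence also the
      dependence of \<open>J_set d i\<close> on \<open>i\<close>.\<close>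
    have [measurable]: "Measurable.pred W (\<lambda>i. j \<in> J_set d i)" for j
      by (simp add: pred_def sets_W space_W)
    show ?thesis
      unfolding T_def antithetic_def by measurable
  qed
  define \<mu> where "\<mu> = distr (W \<Otimes>\<^sub>M std_uniform) (Rd d) T"
  have \<mu>: "prob_space \<mu>" "sets \<mu> = sets (Rd d)"
    unfolding \<mu>_def by (rule P.P.prob_space_distr[OF T]) simp
  have int: "(\<integral>y. g y \<partial>\<mu>) =
      (\<Sum>i\<in>cube (d - 1). w i * (\<integral>u. g (antithetic d (J_set d i) u) \<partial>std_uniform))"
    if g: "integrable \<mu> g" for g :: "(nat \<Rightarrow> real) \<Rightarrow> real"
  proof -
    have [measurable]: "g \<in> borel_measurable (Rd d)"
      using borel_measurable_integrable[OF g] by (simp add: \<mu>_def)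
    have "integrable (W \<Otimes>\<^sub>M std_uniform) (\<lambda>p. g (T p))"
      using g unfolding \<mu>_def by (simp add: integrable_distr_eq)
    note P.integral_fst'[OF this]
    moreover have "(\<integral>y. g y \<partial>\<mu>) = (\<integral>p. g (T p) \<partial>(W \<Otimes>\<^sub>M std_uniform))"
      unfolding \<mu>_def by (rule integral_distr) measurable
    ultimately show ?thesis
      by (simp add: T_def W_def lebesgue_integral_point_measure_finite finite_cube w)
  qed
  have "joint_cdf d \<nu> = joint_cdf d \<mu>"
  proof
    fix u
    let ?Q = "{x \<in> space (Rd d). \<forall>j\<in>{1..d}. x j \<le> u j}"
    have Q [measurable]: "?Q \<in> sets (Rd d)"
      by measurable
    interpret \<mu>: prob_space \<mu> by fact
    \<comment> \<open>The integral formula, applied to the indicator of a quadrant, evaluates the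
      joint cdf of \<open>\<mu>\<close> as the given mixture.\<close>
    have "joint_cdf d \<mu> u = (\<integral>y. indicator ?Q y \<partial>\<mu>)"
      by (simp add: joint_cdf_def \<mu>_def)
    also have "\<dots> = (\<Sum>i\<in>cube (d - 1). w i *
        (\<integral>v. indicator ?Q (antithetic d (J_set d i) v) \<partial>std_uniform))"
      using \<mu>(2) Q by (intro int) (simp add: \<mu>.emeasure_eq_measure)
    also have "\<dots> = (\<Sum>i\<in>cube (d - 1). w i * extremal_copula d i u)"
    proof (intro sum.cong refl arg_cong2[where f = "(*)"])
      fix i
      have "(\<integral>v. indicator ?Q (antithetic d (J_set d i) v) \<partial>std_uniform) =
          (\<integral>y. indicator ?Q y \<partial>distr std_uniform (Rd d) (antithetic d (J_set d i)) :: real)"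
        by (subst integral_distr) measurable
      also have "\<dots> = extremal_copula d i u"
        by (simp add: extremal_copula_antithetic joint_cdf_def)
      finally show "(\<integral>v. indicator ?Q (antithetic d (J_set d i) v) \<partial>std_uniform) = extremal_copula d i u" .
    qed
    finally show "joint_cdf d \<nu> u = joint_cdf d \<mu> u"
      by (simp add: cdf)
  qed
  then have eq: "\<nu> = \<mu>"
    by (intro joint_cdf_determines_law[of _ _ d] \<nu> \<mu>)
  have ae: "AE y in \<mu>. \<forall>j\<in>{1..d}. 0 \<le> y j \<and> y j \<le> 1"
  proof -
    have "AE p in W \<Otimes>\<^sub>M std_uniform. 0 \<le> snd p \<and> snd p \<le> 1"
    proof (rule P.AE_pair_measure)
      show "AE i in W. AE u in std_uniform. 0 \<le> snd (i, u) \<and> snd (i, u) \<le> 1"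
        using AE_std_uniform by simp
    qed measurable
    then have "AE p in W \<Otimes>\<^sub>M std_uniform. \<forall>j\<in>{1..d}. 0 \<le> T p j \<and> T p j \<le> 1"
      by eventually_elim (auto simp: T_def antithetic_def)
    then show ?thesis
      unfolding \<mu>_def by (subst AE_distr_iff) simp_all
  qed
  show ?thesis
    unfolding eq by (intro exI[of _ w] conjI ballI allI impI) (fact w ae int)+
qed

section \<open>Antipodal pairs in the cube and balance\<close>

lemma flip_cube: "x \<in> cube d \<Longrightarrow> flip d x \<in> cube d"
  by (auto simp: cube_def flip_def PiE_iff)

lemma flip_flip: "x \<in> cube d \<Longrightarrow> flip d (flip d x) = x"
  by (auto simp: cube_def flip_def PiE_iff fun_eq_iff extensional_def)

lemma sum_cube:
  assumes "x \<in> cube d"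
  shows "(\<Sum>j\<in>{1..d}. x j) = card {j \<in> {1..d}. x j = 1}"
proof -
  have "(\<Sum>j\<in>{1..d}. x j) = (\<Sum>j\<in>{1..d}. if x j = 1 then 1 else 0)"
    using assms by (intro sum.cong) (auto simp: cube_def PiE_iff)
  then show ?thesis by (simp add: sum.If_cases Int_def)
qed

lemma sum_flip: "(\<Sum>j\<in>{1..d}. flip d x j) = d - (\<Sum>j\<in>{1..d}. x j)"
  by (simp add: flip_def sum_subtractf)

text \<open>The two masses \<open>1/2\<close> exhaust the law once the points are distinct, which
  coordinate \<open>d\<close> shows, as \<open>d \<ge> 1\<close> makes it a genuine coordinate.
  Exactly one point of the pair has a \<open>0\<close> there; it is taken as \<open>s\<close>, as in
  \<open>s_vec\<close>.\<close>

lemma B_K_support: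
  assumes "f \<in> B_K d" "d \<ge> 1"
  obtains s where "s \<in> cube d" "s d = 0" "set_pmf f \<subseteq> {s, flip d s}"
proof -
  from assms obtain x where x: "x \<in> cube d" and p: "pmf f x = 1/2" "pmf f (flip d x) = 1/2"
    by (auto simp: B_K_def)
  have xd: "x d = 0 \<or> x d = 1" and fd: "flip d x d = 1 - x d"
    using x assms(2) by (auto simp: cube_def PiE_iff flip_def)
  have "flip d x \<noteq> x"
  proof
    assume "flip d x = x"
    then show False using xd fd by simp
  qed
  then have "measure (measure_pmf f) {x, flip d x} = 1"
    using p by (simp add: measure_measure_pmf_finite)
  then have supp: "set_pmf f \<subseteq> {x, flip d x}"
    by (subst (asm) measure_pmf.prob_eq_1) (auto simp: AE_measure_pmf_iff)
  show ?thesis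
  proof (cases "x d = 0")
    case True
    then show ?thesis using that x supp by blast
  next
    case False
    then show ?thesis
      using that[of "flip d x"] xd fd supp x by (auto simp: flip_cube flip_flip)
  qed
qed

text \<open>At each coordinate the pair takes the values \<open>0\<close> and \<open>1\<close> once
  each, so \<open>x j = 1\<close> maps it bijectively onto the truth values, where the uniform law
  is Bernoulli with mean \<open>1/2\<close>.\<close>

lemma pmf_of_antipodal_pair_SB:
  assumes "y \<in> cube d"
  shows "pmf_of_set {y, flip d y} \<in> SB d"
  unfolding SB_def
proof (intro CollectI conjI ballI)
  show "set_pmf (pmf_of_set {y, flip d y}) \<subseteq> cube d"
    using assms by (simp add: flip_cube)
  fix j assume j: "j \<in> {1..d}"
  have y: "y j = 0 \<or> y j = 1" and fy: "flip d y j = 1 - y j"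
    using assms j by (auto simp: cube_def PiE_iff flip_def)
  then have "inj_on (\<lambda>x. x j = 1) {y, flip d y}" "(\<lambda>x. x j = 1) ` {y, flip d y} = UNIV"
    by (auto simp: inj_on_def UNIV_bool)
  then show "map_pmf (\<lambda>x. x j = 1) (pmf_of_set {y, flip d y}) = bernoulli_pmf (1/2)"
    by (simp add: map_pmf_of_set_inj bernoulli_pmf_half_conv_pmf_of_set)
qed

lemma convex_on_square_shift: "convex_on UNIV (\<lambda>t::real. (t - c)\<^sup>2)"
proof (rule f''_ge0_imp_convex[where f' = "\<lambda>t. 2 * (t - c)" and f'' = "\<lambda>_. 2"])
qed (auto intro!: derivative_eq_intros)

text \<open>
  Testing the convex order with the squared deviation from \<open>d/2\<close>, against an antipodal pair
  whose first point has \<open>d div 2\<close> ones.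
\<close>

lemma smallest_antipodal_balanced:
  fixes k :: real
  assumes M: "prob_space M" and X: "Sigma_cx_smallest d (SB_laws d) M X"
    and supp: "AE \<omega> in M. (\<Sum>j\<in>{1..d}. X \<omega> j) = k \<or> (\<Sum>j\<in>{1..d}. X \<omega> j) = d - k"
  shows "\<bar>k - d / 2\<bar> \<le> 1 / 2"
proof -
  interpret prob_space M by fact
  have [measurable]: "X \<in> measurable M (Rd d)"
    using X by (simp add: Sigma_cx_smallest_def)
  define y :: "nat \<Rightarrow> real" where "y = (\<lambda>j\<in>{1..d}. if j \<le> d div 2 then 1 else 0)"
  have y: "y \<in> cube d"
    by (auto simp: y_def cube_def)
  have "{j \<in> {1..d}. y j = 1} = {1..d div 2}"
    by (auto simp: y_def)
  then have sum_y: "(\<Sum>j\<in>{1..d}. y j) = real (d div 2)"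
    using sum_cube[OF y] by simp
  define g where "g = pmf_of_set {y, flip d y}"
  let ?\<phi> = "\<lambda>t::real. (t - d / 2)\<^sup>2"
  \<comment> \<open>The deviation is \<open>0\<close> for even \<open>d\<close> and
    \<open>1/2\<close> in absolute value for odd \<open>d\<close>.\<close>
  have half: "?\<phi> (real (d div 2)) \<le> 1 / 4"
    by (cases "even d") (auto elim!: oddE evenE simp: power2_eq_square field_simps)
  have restrict: "(\<lambda>x. restrict x {1..d}) \<in> measurable (measure_pmf g) (Rd d)"
    by (auto simp: space_PiM)
  \<comment> \<open>Flipping turns a sum \<open>t\<close> into \<open>d - t\<close>, so the squared
    deviation has the same value at both points; the same argument serves for \<open>X\<close>
    below.\<close>
  have law: "AE z in law_of_pmf d g. ?\<phi> (\<Sum>j\<in>{1..d}. z j) = ?\<phi> (real (d div 2))"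
  proof -
    have "?\<phi> (\<Sum>j\<in>{1..d}. x j) = ?\<phi> (real (d div 2))" if "x \<in> {y, flip d y}" for x
      using that
    proof (elim insertE emptyE)
      assume "x = flip d y"
      then show ?thesis
        unfolding sum_flip sum_y by (simp add: power2_eq_square field_simps sum_flip sum_y)
    qed (simp only: sum_y)
    then have "AE x in measure_pmf g. ?\<phi> (\<Sum>j\<in>{1..d}. x j) = ?\<phi> (real (d div 2))"
      by (simp add: AE_measure_pmf_iff g_def)
    then show ?thesis
      unfolding law_of_pmf_def by (subst AE_distr_iff[OF restrict]) simp_all
  qed
  interpret g: prob_space "law_of_pmf d g"
    unfolding law_of_pmf_def by (rule measure_pmf.prob_space_distr[OF restrict])
  have [measurable_cong]: "sets (law_of_pmf d g) = sets (Rd d)"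
    by (simp add: law_of_pmf_def)
  have le: "convex_le M (\<lambda>\<omega>. \<Sum>j\<in>{1..d}. X \<omega> j) (law_of_pmf d g) (\<lambda>z. \<Sum>j\<in>{1..d}. z j)"
    using X pmf_of_antipodal_pair_SB[OF y] by (auto simp: Sigma_cx_smallest_def SB_laws_def g_def)
  have AE_M: "AE \<omega> in M. ?\<phi> (\<Sum>j\<in>{1..d}. X \<omega> j) = ?\<phi> k"
  proof -
    have "?\<phi> (d - k) = ?\<phi> k"
      by (simp add: power2_eq_square field_simps)
    then show ?thesis
      using supp by (auto elim!: eventually_mono)
  qed
  \<comment> \<open>The order compares existing expectations only; both test variables are almost
    surely constant, hence integrable.\<close>
  have "integrable M (\<lambda>\<omega>. ?\<phi> (\<Sum>j\<in>{1..d}. X \<omega> j)) \<longleftrightarrow> integrable M (\<lambda>_. ?\<phi> k)"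
    using AE_M by (intro integrable_cong_AE) auto
  moreover have "integrable (law_of_pmf d g) (\<lambda>z. ?\<phi> (\<Sum>j\<in>{1..d}. z j)) \<longleftrightarrow>
      integrable (law_of_pmf d g) (\<lambda>_. ?\<phi> (real (d div 2)))"
    using law by (intro integrable_cong_AE) auto
  ultimately have "(\<integral>\<omega>. ?\<phi> (\<Sum>j\<in>{1..d}. X \<omega> j) \<partial>M) \<le> (\<integral>z. ?\<phi> (\<Sum>j\<in>{1..d}. z j) \<partial>law_of_pmf d g)"
    using le[unfolded convex_le_def, THEN conjunct2, THEN conjunct2, rule_format,
        OF convex_on_square_shift[of "d / 2"]] by simp
  also have "(\<integral>\<omega>. ?\<phi> (\<Sum>j\<in>{1..d}. X \<omega> j) \<partial>M) = (\<integral>\<omega>. ?\<phi> k \<partial>M)"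
    using AE_M by (intro integral_cong_AE) auto
  also have "(\<integral>z. ?\<phi> (\<Sum>j\<in>{1..d}. z j) \<partial>law_of_pmf d g) =
      (\<integral>z. ?\<phi> (real (d div 2)) \<partial>law_of_pmf d g)"
    using law by (intro integral_cong_AE) auto
  finally have "?\<phi> k \<le> (1 / 2)\<^sup>2"
    using half by (simp add: prob_space g.prob_space power2_eq_square)
  then show ?thesis
    using abs_le_square_iff[of "k - d / 2" "1 / 2"] by simp
qed

section \<open>Random reflection and membership in the extremal mixtures\<close>

text \<open>Independence leaves \<open>U\<close> uniform on \<open>X \<in> B\<close>, and it leaves
  \<open>1 - U\<close> uniform off \<open>B\<close> by reflection symmetry; gluing the two events
  together keeps the law.\<close>

lemma uniform_random_reflection:
  assumes M: "prob_space M" and [measurable]: "X \<in> measurable M N" "U \<in> borel_measurable M"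
    and unif: "distr M borel U = std_uniform" and ind: "indep_rvs M borel U N X"
    and B [measurable]: "B \<in> sets N"
  shows "distr M borel (\<lambda>\<omega>. if X \<omega> \<in> B then U \<omega> else 1 - U \<omega>) = std_uniform"
proof (rule measure_eqI)
  interpret prob_space M by fact
  interpret S: prob_space std_uniform by (rule prob_space_std_uniform)
  have [measurable]: "Measurable.pred N (\<lambda>x. x \<in> B)" by measurable
  have indep: "prob ((U -` A \<inter> space M) \<inter> (X -` C \<inter> space M)) =
      measure std_uniform A * prob (X -` C \<inter> space M)"
    if [measurable]: "A \<in> sets borel" "C \<in> sets N" for A C
  proof -
    have "prob (U -` A \<inter> space M) = measure std_uniform A"
      unfolding unif[symmetric] by (simp add: measure_distr)
    moreover have "U -` A \<inter> space M \<in> {U -` A \<inter> space M | A. A \<in> sets borel}"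
      "X -` C \<inter> space M \<in> {X -` C \<inter> space M | C. C \<in> sets N}"
      using that by blast+
    ultimately show ?thesis
      using indep_setD[OF ind[unfolded indep_rvs_def]] by simp
  qed
  fix A assume "A \<in> sets (distr M borel (\<lambda>\<omega>. if X \<omega> \<in> B then U \<omega> else 1 - U \<omega>))"
  then have A [measurable]: "A \<in> sets borel" by simp
  define A' where "A' = (\<lambda>u. 1 - u) -` A"
  have A' [measurable]: "A' \<in> sets borel"
    using measurable_sets[of "\<lambda>u. 1 - u" borel borel A] by (simp add: A'_def)
  have refl: "measure std_uniform A' = measure std_uniform A"
  proof -
    have "measure (distr std_uniform borel (\<lambda>u. 1 - u)) A = measure std_uniform A'"
      by (subst measure_distr) (simp_all add: A'_def)
    then show ?thesis by (simp add: std_uniform_reflect)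
  qed
  let ?C = "space N - B"
  have split: "(\<lambda>\<omega>. if X \<omega> \<in> B then U \<omega> else 1 - U \<omega>) -` A \<inter> space M =
      ((U -` A \<inter> space M) \<inter> (X -` B \<inter> space M)) \<union> ((U -` A' \<inter> space M) \<inter> (X -` ?C \<inter> space M))"
    using measurable_space[OF assms(2)] by (auto simp: A'_def split: if_splits)
  have "prob ((\<lambda>\<omega>. if X \<omega> \<in> B then U \<omega> else 1 - U \<omega>) -` A \<inter> space M) =
      measure std_uniform A * (prob (X -` B \<inter> space M) + prob (X -` ?C \<inter> space M))"
    unfolding split
    by (subst finite_measure_Union) (auto simp: indep refl distrib_left)
  also have "prob (X -` B \<inter> space M) + prob (X -` ?C \<inter> space M) = prob (space M)"
  proof -
    have "X -` ?C \<inter> space M = space M - (X -` B \<inter> space M)"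
      using measurable_space[OF assms(2)] by auto
    then show ?thesis
      by (simp add: prob_compl prob_space)
  qed
  finally have "prob ((\<lambda>\<omega>. if X \<omega> \<in> B then U \<omega> else 1 - U \<omega>) -` A \<inter> space M) = measure std_uniform A"
    by (simp add: prob_space)
  then show "emeasure (distr M borel (\<lambda>\<omega>. if X \<omega> \<in> B then U \<omega> else 1 - U \<omega>)) A =
      emeasure std_uniform A"
    by (simp add: emeasure_distr emeasure_eq_measure S.emeasure_eq_measure)
qed simp

text \<open>This is the mixture with all its weight on one index.\<close>

lemma antithetic_law_EM:
  assumes "d \<ge> 1" and s: "s \<in> cube d" "s d = 0"
  shows "distr std_uniform (Rd d) (antithetic d {j \<in> {1..d}. s j = 1}) \<in> EM_laws d"
proof -
  interpret S: prob_space std_uniform by (rule prob_space_std_uniform)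
  \<comment> \<open>Dropping the last coordinate of \<open>s\<close> loses nothing:
    \<open>s_vec\<close> puts back a \<open>0\<close>, which is the value of
    \<open>s d\<close>.\<close>
  define i where "i = restrict s {1..d - 1}"
  have i: "i \<in> cube (d - 1)"
    using s by (auto simp: i_def cube_def PiE_iff)
  have J: "J_set d i = {j \<in> {1..d}. s j = 1}"
  proof -
    have "j \<le> d - 1" if "j \<le> d" "s j = 1" for j
      using s(2) that by (cases "j = d") auto
    then show ?thesis
      using s(2) by (auto simp: J_set_def s_vec_def i_def)
  qed
  let ?w = "\<lambda>k. if k = i then 1 else (0 :: real)"
  have "joint_cdf d (distr std_uniform (Rd d) (antithetic d (J_set d i))) =
      (\<lambda>u. \<Sum>k\<in>cube (d - 1). ?w k * extremal_copula d k u)"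
    using i by (simp add: extremal_copula_antithetic[symmetric] if_distrib[of "\<lambda>t. t * _"]
        sum.delta finite_cube cong: if_cong)
  moreover have "(\<Sum>k\<in>cube (d - 1). ?w k) = 1"
    using i by (simp add: sum.delta finite_cube)
  ultimately have "joint_cdf d (distr std_uniform (Rd d) (antithetic d (J_set d i))) \<in> EM_copulas d"
    unfolding EM_copulas_def by (intro CollectI exI[of _ ?w]) auto
  then show ?thesis
    unfolding EM_laws_def J[symmetric]
    by (intro CollectI conjI S.prob_space_distr) simp_all
qed

section \<open>Balance and the convex order\<close>

text \<open>
  The deviation from \<open>d/2\<close> is an integer if \<open>d\<close> is even and at least \<open>1/2\<close> if \<open>d\<close> is odd.
\<close>

lemma balanced_minimal:
  fixes m n d :: nat
  assumes "\<bar>real m - d / 2\<bar> \<le> 1 / 2"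
  shows "\<bar>real m - d / 2\<bar> \<le> \<bar>real n - d / 2\<bar>"
proof -
  have "\<bar>2 * int m - int d\<bar> \<le> 1"
    using assms by linarith
  then have "\<bar>2 * int m - int d\<bar> \<le> \<bar>2 * int n - int d\<bar>"
    by presburger
  then show ?thesis by linarith
qed

text \<open>A competitor is an average of extremal laws, and the balanced set already does at least
  as well against each of them separately.\<close>

lemma balanced_antithetic_convex_le:
  assumes M: "prob_space M" and [measurable]: "U \<in> borel_measurable M"
    and unif: "distr M borel U = std_uniform"
    and J: "J \<subseteq> {1..d}" "\<bar>card J - d / 2\<bar> \<le> 1 / 2" and \<nu>: "\<nu> \<in> EM_laws d"
  shows "convex_le M (\<lambda>\<omega>. \<Sum>j\<in>{1..d}. antithetic d J (U \<omega>) j) \<nu> (\<lambda>y. \<Sum>j\<in>{1..d}. y j)"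
  unfolding convex_le_def
proof (intro conjI allI impI)
  interpret \<nu>: prob_space \<nu> using \<nu> by (simp add: EM_laws_def)
  have [measurable_cong]: "sets \<nu> = sets (Rd d)"
    using \<nu> by (simp add: EM_laws_def)
  obtain w where w: "\<forall>i\<in>cube (d - 1). 0 \<le> w i" "(\<Sum>i\<in>cube (d - 1). w i) = 1"
    and bd: "AE y in \<nu>. \<forall>j\<in>{1..d}. 0 \<le> y j \<and> y j \<le> 1"
    and int: "\<forall>g :: (nat \<Rightarrow> real) \<Rightarrow> real. integrable \<nu> g \<longrightarrow>
      (\<integral>y. g y \<partial>\<nu>) = (\<Sum>i\<in>cube (d - 1). w i * (\<integral>u. g (antithetic d (J_set d i) u) \<partial>std_uniform))"
    using EM_law_mixture[OF \<nu>] by (elim exE conjE) (rule that)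
  have sum: "(\<Sum>j\<in>{1..d}. antithetic d K u j) = d / 2 + (2 * u - 1) * (card K - d / 2)"
    if "K \<subseteq> {1..d}" for K u
    using sum_antithetic[OF that order_refl, of u] that by (simp add: Int_absorb1)
  have to_unif: "(\<integral>\<omega>. g (U \<omega>) \<partial>M) = (\<integral>u. g u \<partial>std_uniform)"
    "integrable M (\<lambda>\<omega>. g (U \<omega>)) \<longleftrightarrow> integrable std_uniform g"
    if [measurable]: "g \<in> borel_measurable borel" for g :: "real \<Rightarrow> real"
    unfolding unif[symmetric] by (simp_all add: integral_distr integrable_distr_eq)
  show "integrable M (\<lambda>\<omega>. \<Sum>j\<in>{1..d}. antithetic d J (U \<omega>) j)"
    unfolding sum[OF J(1)]
    by (subst to_unif(2)) (auto intro!: integrable_std_uniform_continuous continuous_intros)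
  have "AE y in \<nu>. norm (\<Sum>j\<in>{1..d}. y j) \<le> real d"
    using bd
  proof eventually_elim
    case (elim y)
    then show ?case
      using sum_bounded_above[of "{1..d}" y 1] sum_nonneg[of "{1..d}" y] by simp
  qed
  then show "integrable \<nu> (\<lambda>y. \<Sum>j\<in>{1..d}. y j)"
    by (rule \<nu>.integrable_const_bound) measurable
  fix \<phi> :: "real \<Rightarrow> real"
  assume \<phi>: "convex_on UNIV \<phi>" and "integrable \<nu> (\<lambda>y. \<phi> (\<Sum>j\<in>{1..d}. y j))"
  note int = int[rule_format, OF this(2)]
  have [measurable]: "\<phi> \<in> borel_measurable borel"
    using convex_on_continuous[OF open_UNIV \<phi>] by (rule borel_measurable_continuous_onI)
  let ?E = "\<lambda>K. \<integral>u. \<phi> (d / 2 + (2 * u - 1) * (card K - d / 2)) \<partial>std_uniform"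
  have "(\<integral>\<omega>. \<phi> (\<Sum>j\<in>{1..d}. antithetic d J (U \<omega>) j) \<partial>M) = ?E J"
    unfolding sum[OF J(1)] by (rule to_unif(1)) measurable
  \<comment> \<open>The weights sum to \<open>1\<close>, so the constant can be spread over the
    components and compared term by term.\<close>
  also have "\<dots> = (\<Sum>i\<in>cube (d - 1). w i * ?E J)"
    using w(2) by (simp add: sum_distrib_right[symmetric])
  also have "\<dots> \<le> (\<Sum>i\<in>cube (d - 1). w i * ?E (J_set d i))"
    by (intro sum_mono mult_left_mono w(1)[rule_format] convex_symmetric_uniform_mono \<phi> balanced_minimal J(2))
  also have "\<dots> = (\<integral>y. \<phi> (\<Sum>j\<in>{1..d}. y j) \<partial>\<nu>)"
    unfolding int sum[OF J_set_subset] ..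
  finally show "(\<integral>\<omega>. \<phi> (\<Sum>j\<in>{1..d}. antithetic d J (U \<omega>) j) \<partial>M) \<le>
      (\<integral>y. \<phi> (\<Sum>j\<in>{1..d}. y j) \<partial>\<nu>)" .
qed

text \<open>Needed because \<open>V\<close> coincides with an antithetic vector only almost surely.
  Convex functions are continuous, hence Borel, so their expectations do not see null sets
  either.\<close>

lemma convex_le_cong_AE:
  assumes [measurable]: "Y \<in> borel_measurable M" "Y' \<in> borel_measurable M"
    and eq: "AE \<omega> in M. Y \<omega> = Y' \<omega>" and le: "convex_le M Y' N Z"
  shows "convex_le M Y N Z"
proof -
  have [measurable]: "\<phi> \<in> borel_measurable borel" if "convex_on UNIV \<phi>" for \<phi> :: "real \<Rightarrow> real"
    using convex_on_continuous[OF open_UNIV that] by (rule borel_measurable_continuous_onI)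
  have "integrable M Y \<longleftrightarrow> integrable M Y'"
    using eq by (intro integrable_cong_AE) auto
  moreover have "integrable M (\<lambda>\<omega>. \<phi> (Y \<omega>)) \<longleftrightarrow> integrable M (\<lambda>\<omega>. \<phi> (Y' \<omega>))"
    "(\<integral>\<omega>. \<phi> (Y \<omega>) \<partial>M) = (\<integral>\<omega>. \<phi> (Y' \<omega>) \<partial>M)" if [simp]: "convex_on UNIV \<phi>" for \<phi> :: "real \<Rightarrow> real"
  proof -
    show "integrable M (\<lambda>\<omega>. \<phi> (Y \<omega>)) \<longleftrightarrow> integrable M (\<lambda>\<omega>. \<phi> (Y' \<omega>))"
      using eq by (intro integrable_cong_AE) auto
    show "(\<integral>\<omega>. \<phi> (Y \<omega>) \<partial>M) = (\<integral>\<omega>. \<phi> (Y' \<omega>) \<partial>M)"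
      using eq by (intro integral_cong_AE) auto
  qed
  ultimately show ?thesis
    using le by (simp add: convex_le_def)
qed

section \<open>Balance and countermonotonicity\<close>

text \<open>
  The two partial sums are affine in the uniform variable, with integer slopes \<open>m\<close> and \<open>n\<close>; balance
  means \<open>|m + n| \<le> 1\<close>, which rules out slopes of equal sign.
\<close>

lemma balanced_antithetic_increments:
  assumes J: "J \<subseteq> {1..d}" "\<bar>card J - d / 2\<bar> \<le> 1 / 2" and K: "K \<subseteq> {1..d}"
  shows "((\<Sum>j\<in>K. antithetic d J u j) - (\<Sum>j\<in>K. antithetic d J v j)) *
    ((\<Sum>j\<in>{1..d} - K. antithetic d J u j) - (\<Sum>j\<in>{1..d} - K. antithetic d J v j)) \<le> 0"
proof -
  let ?m = "2 * int (card (K \<inter> J)) - int (card K)"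
  let ?n = "2 * int (card (({1..d} - K) \<inter> J)) - int (card ({1..d} - K))"
  have fin: "finite J" "finite K"
    using J(1) K finite_subset by blast+
  have "card (K \<inter> J) + card (({1..d} - K) \<inter> J) = card J"
    using J(1) fin by (subst card_Un_disjoint[symmetric]) (auto intro!: arg_cong[where f = card])
  moreover have "card K + card ({1..d} - K) = d"
    using K fin by (subst card_Un_disjoint[symmetric]) (auto simp: Un_absorb1)
  \<comment> \<open>The sum \<open>?m + ?n\<close> is \<open>2 * card J - d\<close>, independently
    of \<open>K\<close>.\<close>
  ultimately have "\<bar>?m + ?n\<bar> \<le> 1"
    using J(2) by linarith
  then have "?m \<le> 0 \<and> 0 \<le> ?n \<or> 0 \<le> ?m \<and> ?n \<le> 0"
    by linarith
  then have "?m * ?n \<le> 0"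
    by (auto simp: mult_le_0_iff)
  \<comment> \<open>The product of the two increments equals
    \<open>?m * ?n * (u - v)\<^sup>2\<close>.\<close>
  then have "of_int (?m * ?n) * (u - v)\<^sup>2 \<le> (0 :: real)"
    by (intro mult_nonpos_nonneg) (simp_all only: of_int_le_0_iff zero_le_power2)
  then show ?thesis
    unfolding sum_antithetic[OF J(1) K] sum_antithetic[OF J(1) Diff_subset]
    by (simp add: power2_eq_square field_simps)
qed

text \<open>For almost every first copy, almost every second copy also lies in \<open>A\<close>, so
  almost every pair satisfies the inequality on the product space.\<close>

lemma countermonotonicI_AE:
  assumes M: "prob_space M" and [measurable]: "X \<in> borel_measurable M" "Y \<in> borel_measurable M"
    and Z: "AE \<omega> in M. \<omega> \<in> A"
    and le: "\<And>\<omega> \<omega>'. \<omega> \<in> A \<Longrightarrow> \<omega>' \<in> A \<Longrightarrow> (X \<omega> - X \<omega>') * (Y \<omega> - Y \<omega>') \<le> 0"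
  shows "countermonotonic M X Y"
proof -
  interpret prob_space M by fact
  interpret P: pair_prob_space M M ..
  have "AE p in M \<Otimes>\<^sub>M M. (X (fst p) - X (snd p)) * (Y (fst p) - Y (snd p)) \<le> 0"
  proof (rule P.AE_pair_measure)
    show "AE x in M. AE y in M. (X (fst (x, y)) - X (snd (x, y))) * (Y (fst (x, y)) - Y (snd (x, y))) \<le> 0"
      using Z
    proof eventually_elim
      case (elim x)
      show ?case
        using Z by eventually_elim (simp add: le elim)
    qed
  qed measurable
  then show ?thesis
    unfolding countermonotonic_def by (subst P.P.prob_Collect_eq_1) measurable
qed

section \<open>The vector \<open>V\<close> as an antithetic vector of a uniform variable\<close>

theorem proposition3p6:
  fixes d :: nat
    and M :: "'a measure"
    and X :: "'a \<Rightarrow> nat \<Rightarrow> real"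
    and U :: "'a \<Rightarrow> real"
    and V :: "'a \<Rightarrow> nat \<Rightarrow> real"
    and f :: "(nat \<Rightarrow> real) pmf"
  assumes "d \<ge> 1"
    and "prob_space M"
    and "X \<in> measurable M (Rd d)"
    and "distr M (Rd d) X = law_of_pmf d f"
    and "f \<in> B_K d"
    and "Sigma_cx_smallest d (SB_laws d) M X"
    and "U \<in> borel_measurable M"
    and "distr M borel U = std_uniform"
    and "indep_rvs M borel U (Rd d) X"
    and "V = (\<lambda>\<omega>. \<lambda>j\<in>{1..d}. U \<omega> * X \<omega> j + (1 - U \<omega>) * (1 - X \<omega> j))"
  shows "Sigma_cx_smallest d (EM_laws d) M V \<and> Sigma_countermonotonic d M V"
proof -
  note d = assms(1) and M = assms(2) and law_X = assms(4) and smallest = assms(6) and V = assms(10)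
  note [measurable] = assms(3,7)
  interpret prob_space M by fact
  obtain s where s: "s \<in> cube d" "s d = 0" and supp: "set_pmf f \<subseteq> {s, flip d s}"
    using B_K_support[OF assms(5) d] .
  define J where "J = {j \<in> {1..d}. s j = 1}"
  have J: "J \<subseteq> {1..d}"
    by (auto simp: J_def)
  have s01: "s j = (if j \<in> J then 1 else 0)" if "j \<in> {1..d}" for j
    using s(1) that by (auto simp: J_def cube_def PiE_iff)
  \<comment> \<open>Stated coordinatewise on \<open>{1..d}\<close>, the support condition is a
    measurable predicate on \<open>Rd d\<close> and passes from the pmf to the law of
    \<open>X\<close>.\<close>
  let ?P = "\<lambda>x. (\<forall>j\<in>{1..d}. x j = s j) \<or> (\<forall>j\<in>{1..d}. x j = 1 - s j)"
  have AE_X: "AE \<omega> in M. ?P (X \<omega>)"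
  proof -
    have restrict: "(\<lambda>x. restrict x {1..d}) \<in> measurable (measure_pmf f) (Rd d)"
      by (auto simp: space_PiM)
    have "?P (restrict x {1..d})" if "x \<in> {s, flip d s}" for x
      using that by (auto simp: flip_def)
    then have "AE x in measure_pmf f. ?P (restrict x {1..d})"
      using supp by (auto simp: AE_measure_pmf_iff)
    then have "AE x in distr M (Rd d) X. ?P x"
      unfolding law_X law_of_pmf_def by (subst AE_distr_iff[OF restrict]) simp_all
    then show ?thesis
      by (subst (asm) AE_distr_iff) simp_all
  qed
  have sum_s: "(\<Sum>j\<in>{1..d}. s j) = card J"
    unfolding J_def by (rule sum_cube[OF s(1)])
  have "AE \<omega> in M. (\<Sum>j\<in>{1..d}. X \<omega> j) = card J \<or> (\<Sum>j\<in>{1..d}. X \<omega> j) = d - real (card J)"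
    using AE_X
  proof eventually_elim
    case (elim \<omega>)
    then show ?case
    proof (elim disjE)
      assume "\<forall>j\<in>{1..d}. X \<omega> j = s j"
      then have "(\<Sum>j\<in>{1..d}. X \<omega> j) = (\<Sum>j\<in>{1..d}. s j)"
        by (intro sum.cong) auto
      then show ?thesis by (simp add: sum_s)
    next
      assume "\<forall>j\<in>{1..d}. X \<omega> j = 1 - s j"
      then have "(\<Sum>j\<in>{1..d}. X \<omega> j) = (\<Sum>j\<in>{1..d}. 1 - s j)"
        by (intro sum.cong) auto
      then show ?thesis by (simp add: sum_s sum_subtractf)
    qed
  qed
  then have bal: "\<bar>card J - d / 2\<bar> \<le> 1 / 2"
    by (rule smallest_antipodal_balanced[OF M smallest])
  \<comment> \<open>As \<open>s d = 0\<close>, the last coordinate tells \<open>s\<close> from its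
    antipode; \<open>B\<close> is the event that selects \<open>s\<close>.\<close>
  define B where "B = {x \<in> space (Rd d). x d = 0}"
  have B: "B \<in> sets (Rd d)"
  proof -
    have [measurable]: "(\<lambda>x. x d) \<in> borel_measurable (Rd d)"
      using d by (intro measurable_component_singleton) simp
    show ?thesis
      unfolding B_def by measurable
  qed
  define U' where "U' = (\<lambda>\<omega>. if X \<omega> \<in> B then U \<omega> else 1 - U \<omega>)"
  have U' [measurable]: "U' \<in> borel_measurable M"
    using B unfolding U'_def by measurable
  have unif: "distr M borel U' = std_uniform"
    unfolding U'_def by (rule uniform_random_reflection[OF M assms(3,7,8,9) B])
  have [measurable]: "V \<in> measurable M (Rd d)"
    unfolding V by measurable
  \<comment> \<open>On \<open>X = s\<close> the coordinates of \<open>V\<close> in \<open>J\<close>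
    are \<open>U\<close> and the others \<open>1 - U\<close>. On the antipode the two roles are
    swapped, and \<open>U' = 1 - U\<close> undoes the swap.\<close>
  have AE_V: "AE \<omega> in M. V \<omega> = antithetic d J (U' \<omega>)"
    using AE_X
  proof (rule AE_mp[OF _ AE_I2], intro impI)
    fix \<omega> assume \<omega>: "\<omega> \<in> space M" and X: "?P (X \<omega>)"
    have "X \<omega> \<in> B \<longleftrightarrow> X \<omega> d = 0"
      using measurable_space[OF assms(3) \<omega>] by (simp add: B_def)
    moreover have "d \<in> {1..d}"
      using d by simp
    ultimately show "V \<omega> = antithetic d J (U' \<omega>)"
      using X s(2) by (auto simp: V antithetic_def U'_def s01 fun_eq_iff)
  qed
  have "distr M (Rd d) V = distr M (Rd d) (\<lambda>\<omega>. antithetic d J (U' \<omega>))"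
    using AE_V by (intro distr_cong_AE) measurable
  also have "\<dots> = distr std_uniform (Rd d) (antithetic d J)"
    unfolding unif[symmetric] by (subst distr_distr) (simp_all add: comp_def)
  finally have "distr M (Rd d) V \<in> EM_laws d"
    using antithetic_law_EM[OF d s] by (simp add: J_def)
  moreover have "convex_le M (\<lambda>\<omega>. \<Sum>j\<in>{1..d}. V \<omega> j) \<nu> (\<lambda>y. \<Sum>j\<in>{1..d}. y j)"
    if "\<nu> \<in> EM_laws d" for \<nu>
    by (rule convex_le_cong_AE[OF _ _ _ balanced_antithetic_convex_le[OF M U' unif J bal that]])
      (use AE_V in auto)
  moreover have "Sigma_countermonotonic d M V"
    unfolding Sigma_countermonotonic_def
  proof (intro allI impI)
    fix K assume K: "K \<subseteq> {1..d}"
    have [measurable]: "(\<lambda>\<omega>. \<Sum>j\<in>L. V \<omega> j) \<in> borel_measurable M" if "L \<subseteq> {1..d}" for L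
      using that by (intro borel_measurable_sum measurable_compose[OF \<open>V \<in> _\<close>] measurable_component_singleton) auto
    show "countermonotonic M (\<lambda>\<omega>. \<Sum>j\<in>K. V \<omega> j) (\<lambda>\<omega>. \<Sum>j\<in>{1..d} - K. V \<omega> j)"
    proof (rule countermonotonicI_AE[OF M _ _, where A = "{\<omega>. V \<omega> = antithetic d J (U' \<omega>)}"])
      show "AE \<omega> in M. \<omega> \<in> {\<omega>. V \<omega> = antithetic d J (U' \<omega>)}"
        using AE_V by simp
    qed (use K in \<open>auto simp: balanced_antithetic_increments[OF J bal K]\<close>)
  qed
  ultimately show ?thesis
    unfolding Sigma_cx_smallest_def by simp
qed

end
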